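(* Consider a test of a simple null hypothesis $H_0:\theta=\theta_0$ and let $\gamma>0$ be a fixed evidence threshold. Let $\theta^*\in\Theta$. If $$\Omega_\gamma(\theta)\subseteq\Omega_\gamma(\theta^* )\quad\text{for all }\theta\in\Theta,$$ then $H_1:\theta=\theta^*$ (the point mass at $\theta^*$) defines the alternative hypothesis of a UMPBT($\gamma$).
   Context: Let $\Theta\subseteq\mathbb{R}$ be the parameter space over which alternatives and data-generating parameters range, and let $\theta_0\in\mathbb{R}$ be the null value. Let $y\in\mathbb{R}$ be a scalar sufficient statistic of the data, having for each $\theta\in\Theta\cup\{\theta_0\}$ a density $f(y;\theta)$ with respect to a $\sigma$-finite measure $\mu$; the set $S(f)=\{y: f(y;\theta)>0\}$ is assumed not to depend on $\theta$. Measurability in $(y,\theta)$ is assumed so that the integrals below make sense. $\mathbf{P}_{\theta_t}$ denotes probability when $y$ has density $f(\cdot;\theta_t)$. The likelihood ratio in favor of $\theta$ is $g(y,\theta)=f(y;\theta)/f(y;\theta_0)$ for $y\in S(f)$, and for $\gamma>0$, $$\Omega_\gamma(\theta)=\{y: g(y,\theta)>\gamma\}.$$ An alternative hypothesis $H_i:\theta\sim\pi_i$ is given by a prior probability distribution $\pi_i$ on $\Theta$ (point masses, i.e. simple alternatives, are allowed). The Bayes factor in favor of $H_i$ against $H_0:\theta=\theta_0$ is $\mathrm{BF}_{i0}(y)=\int_\Theta g(y,\theta)\,\pi_i(d\theta)$; for a simple alternative $H_1:\theta=\theta_1$ it equals $g(y,\theta_1)$. A uniformly most powerful Bayesian test for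 evidence threshold $\gamma>0$ in favor of $H_1$ against the fixed null $H_0$, denoted UMPBT($\gamma$), is a Bayesian hypothesis test whose Bayes factor satisfies, for every $\theta_t\in\Theta$ and every alternative hypothesis $H_2:\theta\sim\pi_2$, $$\mathbf{P}_{\theta_t}[\mathrm{BF}_{10}(y)>\gamma]\ge \mathbf{P}_{\theta_t}[\mathrm{BF}_{20}(y)>\gamma].$$ *)

theory Defs
  imports "HOL-Probability.Probability"
begin

text \<open>
  \<^term>\<open>f y \<theta>\<close> is the density at \<^term>\<open>y\<close> under the parameter \<^term>\<open>\<theta>\<close>, with respect to the
  dominating measure \<^term>\<open>\<mu>\<close> on the real line.  The null value \<^term>\<open>\<theta>0\<close> need not lie in
  \<^term>\<open>\<Theta>\<close>, and \<^term>\<open>f y \<theta>\<close> is unconstrained for \<^term>\<open>\<theta>\<close> outside \<^term>\<open>insert \<theta>0 \<Theta>\<close>.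
  The parameter space is an arbitrary set of reals with the trace of the Borel sigma-algebra.
\<close>

definition support :: "(real \<Rightarrow> real \<Rightarrow> real) \<Rightarrow> real \<Rightarrow> real set" where
  "support f \<theta> = {y. f y \<theta> > 0}"

locale testing_model = sigma_finite_measure \<mu>
  for \<mu> :: "real measure" and f :: "real \<Rightarrow> real \<Rightarrow> real"
    and \<Theta> :: "real set" and \<theta>0 :: real +
  assumes sets_mu: "sets \<mu> = sets borel"
    and density_measurable:
      "(\<lambda>(y, \<theta>). f y \<theta>) \<in> borel_measurable (\<mu> \<Otimes>\<^sub>M restrict_space borel (insert \<theta>0 \<Theta>))"
    and density_nonneg: "\<And>y \<theta>. \<theta> \<in> insert \<theta>0 \<Theta> \<Longrightarrow> 0 \<le> f y \<theta>"
    and density_integral: "\<And>\<theta>. \<theta> \<in> insert \<theta>0 \<Theta> \<Longrightarrow> (\<integral>\<^sup>+ y. ennreal (f y \<theta>) \<partial>\<mu>) = 1"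
    and common_support: "\<And>\<theta>. \<theta> \<in> insert \<theta>0 \<Theta> \<Longrightarrow> support f \<theta> = support f \<theta>0"

definition likelihood_ratio :: "(real \<Rightarrow> real \<Rightarrow> real) \<Rightarrow> real \<Rightarrow> real \<Rightarrow> real \<Rightarrow> real" where
  "likelihood_ratio f \<theta>0 y \<theta> = f y \<theta> / f y \<theta>0"

text \<open>The likelihood ratio is meaningful only on the common support, hence the explicit restriction
  of the events below.\<close>

definition Omega :: "(real \<Rightarrow> real \<Rightarrow> real) \<Rightarrow> real \<Rightarrow> real \<Rightarrow> real \<Rightarrow> real set" where
  "Omega f \<theta>0 \<gamma> \<theta> = {y \<in> support f \<theta>0. likelihood_ratio f \<theta>0 y \<theta> > \<gamma>}"

definition prior_on :: "real set \<Rightarrow> real measure \<Rightarrow> bool" where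
  "prior_on \<Theta> \<pi> \<longleftrightarrow> prob_space \<pi> \<and> sets \<pi> = sets (restrict_space borel \<Theta>)"

definition point_mass :: "real set \<Rightarrow> real \<Rightarrow> real measure" where
  "point_mass \<Theta> \<theta> = return (restrict_space borel \<Theta>) \<theta>"

text \<open>The Bayes factor is extended-real valued since the integral may diverge; a Bochner integral
  would silently turn that case into 0.\<close>

definition bayes_factor ::
    "(real \<Rightarrow> real \<Rightarrow> real) \<Rightarrow> real \<Rightarrow> real measure \<Rightarrow> real \<Rightarrow> ennreal" where
  "bayes_factor f \<theta>0 \<pi> y = (\<integral>\<^sup>+ \<theta>. ennreal (likelihood_ratio f \<theta>0 y \<theta>) \<partial>\<pi>)"

definition data_dist :: "real measure \<Rightarrow> (real \<Rightarrow> real \<Rightarrow> real) \<Rightarrow> real \<Rightarrow> real measure" where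
  "data_dist \<mu> f \<theta> = density \<mu> (\<lambda>y. ennreal (f y \<theta>))"

definition exceedance_prob ::
    "real measure \<Rightarrow> (real \<Rightarrow> real \<Rightarrow> real) \<Rightarrow> real \<Rightarrow> real \<Rightarrow> real measure \<Rightarrow> real \<Rightarrow> real" where
  "exceedance_prob \<mu> f \<theta>0 \<gamma> \<pi> \<theta>t =
     measure (data_dist \<mu> f \<theta>t) {y \<in> support f \<theta>0. bayes_factor f \<theta>0 \<pi> y > ennreal \<gamma>}"

definition UMPBT ::
    "real measure \<Rightarrow> (real \<Rightarrow> real \<Rightarrow> real) \<Rightarrow> real set \<Rightarrow> real \<Rightarrow> real \<Rightarrow> real measure \<Rightarrow> bool" where
  "UMPBT \<mu> f \<Theta> \<theta>0 \<gamma> \<pi>1 \<longleftrightarrow>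
     prior_on \<Theta> \<pi>1 \<and>
     (\<forall>\<theta>t\<in>\<Theta>. \<forall>\<pi>2. prior_on \<Theta> \<pi>2 \<longrightarrow>
        exceedance_prob \<mu> f \<theta>0 \<gamma> \<pi>1 \<theta>t \<ge> exceedance_prob \<mu> f \<theta>0 \<gamma> \<pi>2 \<theta>t)"

end

theory Submission
  imports Defs
begin

text \<open>
  A Bayes factor is an average of likelihood ratios over the prior, and an average can exceed
  \<open>\<gamma>\<close> only if one of the averaged values does.  The rejection region of any alternative is
  therefore contained in the union of the sets \<open>\<Omega>\<^sub>\<gamma>(\<theta>)\<close> with \<open>\<theta> \<in> \<Theta>\<close>
  (\<open>bayes_factor_region_subset\<close>).  For the point mass at \<open>\<theta>\<^sup>*\<close> the rejection region is
  \<open>\<Omega>\<^sub>\<gamma>(\<theta>\<^sup>*)\<close> itself (\<open>point_mass_region_eq\<close>), which by hypothesis contains that union.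
  The comparison of the two tests is thus an inclusion of regions, valid pointwise in the data,
  and the inequality of probabilities follows by monotonicity whatever the true parameter is.
\<close>

text \<open>
  The prior has total mass one, so a likelihood ratio bounded by \<open>\<gamma>\<close> on all of \<open>\<Theta>\<close> would
  have an average bounded by \<open>\<gamma>\<close>.
\<close>

lemma bayes_factor_region_subset:
  assumes "prior_on \<Theta> \<pi>" and "0 \<le> \<gamma>"
  shows "{y \<in> support f \<theta>0. ennreal \<gamma> < bayes_factor f \<theta>0 \<pi> y} \<subseteq> (\<Union>\<theta>\<in>\<Theta>. Omega f \<theta>0 \<gamma> \<theta>)"
proof clarify
  fix y assume y: "y \<in> support f \<theta>0" and exceeds: "ennreal \<gamma> < bayes_factor f \<theta>0 \<pi> y"
  interpret prob_space \<pi> using assms(1) by (simp add: prior_on_def)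
  have space: "space \<pi> = \<Theta>"
    using assms(1) sets_eq_imp_space_eq[of \<pi> "restrict_space borel \<Theta>"]
    by (simp add: prior_on_def space_restrict_space)
  have "\<exists>\<theta>\<in>\<Theta>. \<gamma> < likelihood_ratio f \<theta>0 y \<theta>"
  proof (rule ccontr)
    assume "\<not> (\<exists>\<theta>\<in>\<Theta>. \<gamma> < likelihood_ratio f \<theta>0 y \<theta>)"
    then have "bayes_factor f \<theta>0 \<pi> y \<le> (\<integral>\<^sup>+ \<theta>. ennreal \<gamma> \<partial>\<pi>)"
      unfolding bayes_factor_def by (intro nn_integral_mono ennreal_leI) (auto simp: space not_less)
    then show False using exceeds by (simp add: emeasure_space_1)
  qed
  with y show "y \<in> (\<Union>\<theta>\<in>\<Theta>. Omega f \<theta>0 \<gamma> \<theta>)" by (auto simp: Omega_def)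
qed

lemma prior_on_point_mass:
  assumes "\<theta> \<in> \<Theta>"
  shows "prior_on \<Theta> (point_mass \<Theta> \<theta>)"
  using assms by (simp add: prior_on_def point_mass_def prob_space_return space_restrict_space)

context testing_model
begin

lemma space_mu: "space \<mu> = UNIV"
  using sets_eq_imp_space_eq[OF sets_mu] by simp

lemma density_measurable_data:
  assumes "\<theta> \<in> insert \<theta>0 \<Theta>"
  shows "(\<lambda>y. f y \<theta>) \<in> borel_measurable \<mu>"
proof -
  have "\<theta> \<in> space (restrict_space borel (insert \<theta>0 \<Theta>))"
    using assms by (simp add: space_restrict_space)
  from measurable_compose[OF measurable_Pair2'[OF this] density_measurable]
  show ?thesis by simp
qed

lemma density_measurable_parameter:
  "(\<lambda>\<theta>. f y \<theta>) \<in> borel_measurable (restrict_space borel \<Theta>)"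
proof -
  have "y \<in> space \<mu>" by (simp add: space_mu)
  from measurable_compose[OF measurable_Pair1'[OF this] density_measurable]
  have "(\<lambda>\<theta>. f y \<theta>) \<in> borel_measurable (restrict_space borel (insert \<theta>0 \<Theta>))" by simp
  then show ?thesis by (rule measurable_restrict_mono) auto
qed

lemma bayes_factor_point_mass:
  assumes "\<theta> \<in> \<Theta>"
  shows "bayes_factor f \<theta>0 (point_mass \<Theta> \<theta>) y = ennreal (likelihood_ratio f \<theta>0 y \<theta>)"
  using assms density_measurable_parameter unfolding bayes_factor_def point_mass_def
  by (intro nn_integral_return) (simp_all add: space_restrict_space likelihood_ratio_def)

lemma point_mass_region_eq:
  assumes "\<theta> \<in> \<Theta>" and "0 \<le> \<gamma>"
  shows "{y \<in> support f \<theta>0. ennreal \<gamma> < bayes_factor f \<theta>0 (point_mass \<Theta> \<theta>) y} = Omega f \<theta>0 \<gamma> \<theta>"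
  using assms by (simp add: bayes_factor_point_mass Omega_def ennreal_less_iff)

lemma Omega_measurable:
  assumes "\<theta> \<in> \<Theta>"
  shows "Omega f \<theta>0 \<gamma> \<theta> \<in> sets \<mu>"
proof -
  have [measurable]: "(\<lambda>y. f y \<theta>) \<in> borel_measurable \<mu>" "(\<lambda>y. f y \<theta>0) \<in> borel_measurable \<mu>"
    using assms by (auto intro: density_measurable_data)
  have "{y \<in> space \<mu>. 0 < f y \<theta>0 \<and> \<gamma> < f y \<theta> / f y \<theta>0} \<in> sets \<mu>" by measurable
  then show ?thesis by (simp add: space_mu Omega_def support_def likelihood_ratio_def)
qed

lemma prob_space_data_dist:
  assumes "\<theta> \<in> insert \<theta>0 \<Theta>"
  shows "prob_space (data_dist \<mu> f \<theta>)"
  using density_measurable_data[OF assms] density_integral[OF assms]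
  by (intro prob_spaceI) (simp add: data_dist_def emeasure_density cong: nn_integral_cong)

end

theorem theorem1:
  fixes \<mu> :: "real measure" and f :: "real \<Rightarrow> real \<Rightarrow> real"
    and \<Theta> :: "real set" and \<theta>0 \<gamma> \<theta>star :: real
  assumes "testing_model \<mu> f \<Theta> \<theta>0"
    and "\<gamma> > 0"
    and "\<theta>star \<in> \<Theta>"
    and "\<And>\<theta>. \<theta> \<in> \<Theta> \<Longrightarrow> Omega f \<theta>0 \<gamma> \<theta> \<subseteq> Omega f \<theta>0 \<gamma> \<theta>star"
  shows "UMPBT \<mu> f \<Theta> \<theta>0 \<gamma> (point_mass \<Theta> \<theta>star)"
proof -
  interpret testing_model \<mu> f \<Theta> \<theta>0 by (fact assms(1))
  have "0 \<le> \<gamma>" using assms(2) by simp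
  have "exceedance_prob \<mu> f \<theta>0 \<gamma> \<pi>2 \<theta>t \<le> exceedance_prob \<mu> f \<theta>0 \<gamma> (point_mass \<Theta> \<theta>star) \<theta>t"
    if "\<theta>t \<in> \<Theta>" and "prior_on \<Theta> \<pi>2" for \<theta>t \<pi>2
  proof -
    interpret data: prob_space "data_dist \<mu> f \<theta>t"
      using that(1) by (intro prob_space_data_dist) simp
    have "{y \<in> support f \<theta>0. ennreal \<gamma> < bayes_factor f \<theta>0 \<pi>2 y} \<subseteq> Omega f \<theta>0 \<gamma> \<theta>star"
      using bayes_factor_region_subset[OF that(2) \<open>0 \<le> \<gamma>\<close>] assms(4) by blast
    moreover have "Omega f \<theta>0 \<gamma> \<theta>star \<in> sets (data_dist \<mu> f \<theta>t)"
      using Omega_measurable[OF assms(3)] by (simp add: data_dist_def)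
    ultimately show ?thesis
      unfolding exceedance_prob_def point_mass_region_eq[OF assms(3) \<open>0 \<le> \<gamma>\<close>]
      by (rule data.finite_measure_mono)
  qed
  with prior_on_point_mass[OF assms(3)] show ?thesis by (simp add: UMPBT_def)
qed

end
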